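(* Let $(\mathcal{P},\mathcal{B})$ be an $\mathrm{SRPG}(s,t;\alpha_1,\dots,\alpha_r;\lambda,\mu)$ with $v=|\mathcal{P}|$ points and incidence matrix $M$. Put $k=s(t+1)$ and $\Delta=(\lambda-\mu)^2+4(k-\mu)$. If $\lambda-\mu\equiv1\pmod 2$, then $$\mathrm{rank}_2(M)\ \ge\ \min\left\{\frac12\Big[(v-1)-\frac{(v-1)(\mu-\lambda)-2k}{\sqrt{\Delta}}\Big],\ \frac12\Big[(v-1)+\frac{(v-1)(\mu-\lambda)-2k}{\sqrt{\Delta}}\Big]\right\}.$$
   Context: A generalized partial geometry of grade $r$, denoted $\mathrm{PG}(s,t;\alpha_1,\dots,\alpha_r)$, is an incidence structure $(\mathcal{P},\mathcal{B})$, with $\mathcal{P}$ a finite non-empty set of points and $\mathcal{B}$ a family of subsets of $\mathcal{P}$ (blocks), incidence being containment, such that: (i) any two distinct points are incident with at most one common block; (ii) each block is incident with exactly $s+1$ points; (iii) each point is incident with exactly $t+1$ blocks; (iv) for any point $P$ and block $B$ with $P\notin B$, there is $\alpha\in\{\alpha_1,\dots,\alpha_r\}$ such that exactly $\alpha$ points of $B$ are joined to $P$ (two points are joined if some block contains both); (v) for each $\alpha\in\{\alpha_1,\dots,\alpha_r\}$ there exist a point $P$ and a block $B$ with $P\notin B$ such that exactly $\alpha$ points of $B$ are joined to $P$. The point graph of $(\mathcal{P},\mathcal{B})$ has vertex set $\mathcal{P}$, two distinct points being adjacent if and only if some block contains both. A $k$-regular graph on $v$ vertices is strongly regular with parameters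 $(v,k,\lambda,\mu)$ if any two adjacent vertices have exactly $\lambda$ common neighbours and any two distinct non-adjacent vertices have exactly $\mu$ common neighbours. A $\mathrm{PG}(s,t;\alpha_1,\dots,\alpha_r)$ whose point graph is strongly regular with parameters $(v,k,\lambda,\mu)$ is denoted $\mathrm{SRPG}(s,t;\alpha_1,\dots,\alpha_r;\lambda,\mu)$; its parameters are $k=s(t+1)$ and $v=\frac{k(k-\lambda-1)}{\mu}+k+1$. The incidence matrix $M$ is the $0/1$ matrix with rows indexed by points and columns by blocks, with entry $1$ exactly when the point lies on the block. $\mathrm{rank}_2(M)$ denotes the rank of $M$ over $\mathbb{F}_2$. *)

theory Defs
  imports
    Complex_Main
    "HOL-Library.Z2"
    "HOL-Number_Theory.Cong"
    "Jordan_Normal_Form.DL_Rank"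
begin

text \<open>
  The values \<open>\<alpha>\<^sub>1, \<dots>, \<alpha>\<^sub>r\<close> enter the definition only through the set
  they form, which is the parameter \<open>As\<close>; its cardinality is the grade \<open>r\<close>.
  In the axiom \<open>antiflag\<close>, the condition \<open>p \<notin> b\<close> makes \<open>p\<close> and \<open>q \<in> b\<close> distinct, so
  \<open>joined\<close> need not require distinctness.
\<close>

definition joined :: "'a set set \<Rightarrow> 'a \<Rightarrow> 'a \<Rightarrow> bool" where
  "joined B p q \<longleftrightarrow> (\<exists>b\<in>B. p \<in> b \<and> q \<in> b)"

locale generalized_partial_geometry =
  fixes P :: "'a set" and B :: "'a set set" and s t r :: nat and As :: "nat set"
  assumes finite_points: "finite P"
    and points_nonempty: "P \<noteq> {}"
    and block_subset: "\<And>b. b \<in> B \<Longrightarrow> b \<subseteq> P"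
    and finite_As: "finite As"
    and card_As: "card As = r"
    and at_most_one_block:
      "\<And>p q b c. \<lbrakk>p \<in> P; q \<in> P; p \<noteq> q; b \<in> B; c \<in> B; p \<in> b; q \<in> b; p \<in> c; q \<in> c\<rbrakk> \<Longrightarrow> b = c"
    and block_card: "\<And>b. b \<in> B \<Longrightarrow> card b = s + 1"
    and point_degree: "\<And>p. p \<in> P \<Longrightarrow> card {b \<in> B. p \<in> b} = t + 1"
    and antiflag: "\<And>p b. \<lbrakk>p \<in> P; b \<in> B; p \<notin> b\<rbrakk> \<Longrightarrow> \<exists>\<alpha>\<in>As. card {q \<in> b. joined B p q} = \<alpha>"
    and attained: "\<And>\<alpha>. \<alpha> \<in> As \<Longrightarrow> \<exists>p\<in>P. \<exists>b\<in>B. p \<notin> b \<and> card {q \<in> b. joined B p q} = \<alpha>"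

definition point_graph_adj :: "'a set set \<Rightarrow> 'a \<Rightarrow> 'a \<Rightarrow> bool" where
  "point_graph_adj B p q \<longleftrightarrow> p \<noteq> q \<and> joined B p q"

text \<open>A simple graph is given by its vertex set \<open>V\<close> and an adjacency relation, of which only the
  restriction to \<open>V\<close> matters.\<close>

locale strongly_regular_graph =
  fixes V :: "'a set" and adj :: "'a \<Rightarrow> 'a \<Rightarrow> bool" and v k l m :: nat
  assumes finite_vertices: "finite V"
    and adj_sym: "\<And>x y. \<lbrakk>x \<in> V; y \<in> V; adj x y\<rbrakk> \<Longrightarrow> adj y x"
    and adj_irrefl: "\<And>x. x \<in> V \<Longrightarrow> \<not> adj x x"
    and card_vertices: "card V = v"
    and regular: "\<And>x. x \<in> V \<Longrightarrow> card {y \<in> V. adj x y} = k"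
    and common_adj: "\<And>x y. \<lbrakk>x \<in> V; y \<in> V; adj x y\<rbrakk> \<Longrightarrow> card {z \<in> V. adj x z \<and> adj y z} = l"
    and common_nonadj:
      "\<And>x y. \<lbrakk>x \<in> V; y \<in> V; x \<noteq> y; \<not> adj x y\<rbrakk> \<Longrightarrow> card {z \<in> V. adj x z \<and> adj y z} = m"

text \<open>
  The valency \<open>k = s (t + 1)\<close> is forced by the axioms of a generalized partial geometry.  The
  relation \<open>v = k (k - l - 1) / m + k + 1\<close> is likewise a consequence whenever \<open>m \<noteq> 0\<close>, and is
  therefore not an axiom.
\<close>

locale strongly_regular_pg =
  generalized_partial_geometry P B s t r As +
  strongly_regular_graph P "point_graph_adj B" "card P" "s * (t + 1)" l m
  for P :: "'a set" and B :: "'a set set" and s t r :: nat and As :: "nat set" and l m :: nat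

text \<open>Matrices are indexed by initial segments of the naturals, so the incidence matrix is taken
  with respect to enumerations \<open>ps\<close> of the points and \<open>bs\<close> of the blocks.\<close>

definition incidence_matrix :: "'a list \<Rightarrow> 'a set list \<Rightarrow> 'f::zero_neq_one mat" where
  "incidence_matrix ps bs =
     mat (length ps) (length bs) (\<lambda>(i, j). if ps ! i \<in> bs ! j then 1 else 0)"

definition rank2 :: "bit mat \<Rightarrow> nat" where
  "rank2 M = vec_space.rank (dim_row M) M"

end

theory Submission
  imports Defs "Jordan_Normal_Form.Schur_Decomposition"
begin

text \<open>
  Let \<open>A\<close> be the adjacency matrix of the point graph, so that \<open>M M\<^sup>T = A + (t + 1) I\<close>.  Over
  \<open>\<complex>\<close>, the characteristic polynomial of \<open>A\<close> is \<open>(x - k) (x - \<theta>\<^sub>1)\<^sup>f (x - \<theta>\<^sub>2)\<^sup>g\<close>, where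
  \<open>\<theta>\<^sub>1, \<theta>\<^sub>2\<close> are the roots of \<open>q = x\<^sup>2 + (\<mu> - \<lambda>) x + (\<mu> - k)\<close>.  As \<open>A\<close> has trace zero, the two numbers in
  the minimum are \<open>f\<close> and \<open>g\<close>.  If \<open>f = g\<close>, the polynomial is \<open>(x - k) q\<^sup>f\<close>, and \<open>q\<close> modulo 2 is
  \<open>x (x + 1)\<close> or \<open>x\<^sup>2 + x + 1\<close>; otherwise the trace makes \<open>\<theta>\<^sub>1, \<theta>\<^sub>2\<close> integers, of opposite parity since
  their sum \<open>\<lambda> - \<mu>\<close> is odd.  In either case a root modulo 2 has multiplicity at most
  \<open>1 + max f g\<close>.  On the other hand, a factorization of \<open>M\<close> through a space of dimension
  \<open>rank\<^sub>2 M\<close> gives \<open>-(t + 1)\<close> multiplicity at least \<open>v - rank\<^sub>2 M = f + g + 1 - rank\<^sub>2 M\<close>.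
\<close>

section \<open>Low-rank factorizations and root multiplicities\<close>

text \<open>Sylvester's determinant identity without division, so that \<open>y\<close> may be a
  polynomial. The block matrix \<open>?X\<close> is multiplied on the right by \<open>?L\<close>,
  which clears \<open>W\<close>, and by \<open>?R\<close>, which clears \<open>U\<close>; the
  products are block triangular.\<close>

lemma det_smult_one_minus_mult_commute:
  fixes y :: "'a :: idom"
  assumes U: "U \<in> carrier_mat n r" and W: "W \<in> carrier_mat r n"
  shows "y ^ r * det (y \<cdot>\<^sub>m 1\<^sub>m n - U * W) = y ^ n * det (y \<cdot>\<^sub>m 1\<^sub>m r - W * U)"
proof -
  let ?X = "four_block_mat (y \<cdot>\<^sub>m 1\<^sub>m n) U W (1\<^sub>m r)"
  let ?L = "four_block_mat (1\<^sub>m n) (0\<^sub>m n r) (- W) (1\<^sub>m r)"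
  let ?R = "four_block_mat (1\<^sub>m n) (- U) (0\<^sub>m r n) (y \<cdot>\<^sub>m 1\<^sub>m r)"
  have X: "?X \<in> carrier_mat (n + r) (n + r)" and L: "?L \<in> carrier_mat (n + r) (n + r)"
    and R: "?R \<in> carrier_mat (n + r) (n + r)"
    using U W by auto
  have UW: "U * W \<in> carrier_mat n n" and WU: "W * U \<in> carrier_mat r r"
    using U W by auto
  have "?X * ?L = four_block_mat (y \<cdot>\<^sub>m 1\<^sub>m n - U * W) U (0\<^sub>m r n) (1\<^sub>m r)"
    by (subst mult_four_block_mat[of _ n n _ r _ r _ _ n _ r])
      (use U W UW in \<open>auto intro!: cong_four_block_mat eq_matI\<close>)
  from arg_cong[OF this, of det] have 1: "det ?X = det (y \<cdot>\<^sub>m 1\<^sub>m n - U * W)"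
    using U W UW by (simp add: det_mult[OF X L] minus_carrier_mat det_four_block_mat_lower_left_zero[of _ n _ r]
        det_four_block_mat_upper_right_zero[of _ n _ r])
  have "?X * ?R = four_block_mat (y \<cdot>\<^sub>m 1\<^sub>m n) (0\<^sub>m n r) W (y \<cdot>\<^sub>m 1\<^sub>m r - W * U)"
    by (subst mult_four_block_mat[of _ n n _ r _ r _ _ n _ r])
      (use U W WU in \<open>auto simp: mult_smult_assoc_mat[of _ n n _ r] mult_smult_distrib[of _ n r _ r]
        intro!: cong_four_block_mat eq_matI\<close>)
  from arg_cong[OF this, of det] have 2: "det ?X * y ^ r = y ^ n * det (y \<cdot>\<^sub>m 1\<^sub>m r - W * U)"
    using U W WU by (simp add: det_mult[OF X R] minus_carrier_mat det_four_block_mat_lower_left_zero[of _ n _ r]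
        det_four_block_mat_upper_right_zero[of _ n _ r])
  show ?thesis using 1 2 by (simp add: mult.commute)
qed

text \<open>The columns of \<open>U\<close> are a maximal independent set of columns of
  \<open>A\<close>; those of \<open>W\<close> hold the coordinates of the columns of
  \<open>A\<close> in that basis.\<close>

lemma (in vec_space) rank_factorization:
  assumes A: "A \<in> carrier_mat n nc"
  obtains U W where "U \<in> carrier_mat n (rank A)" "W \<in> carrier_mat (rank A) nc" "A = U * W"
proof -
  have C: "set (cols A) \<subseteq> carrier_vec n"
    using cols_dim A by blast
  obtain S where S: "maximal S (\<lambda>T. T \<subseteq> set (cols A) \<and> lin_indpt T)" "finite S"
    using maximal_exists_superset[of "set (cols A)" "\<lambda>T. T \<subseteq> set (cols A) \<and> lin_indpt T" "{}"]
    by (auto simp: lin_dep_def)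
  have SC: "S \<subseteq> set (cols A)" "S \<subseteq> carrier_vec n"
    using S(1) C by (auto simp: maximal_def)
  have span: "set (cols A) \<subseteq> span S"
  proof
    fix x assume x: "x \<in> set (cols A)"
    show "x \<in> span S"
    proof (rule ccontr)
      assume "x \<notin> span S"
      moreover have "lin_indpt S" using S(1) by (simp add: maximal_def)
      ultimately have "lin_indpt (S \<union> {x})"
        using lin_dep_iff_in_span[OF SC(2), of x] span_mem[OF SC(2), of x] x C by auto
      with S(1) x SC have "S \<union> {x} = S"
        unfolding maximal_def by blast
      with span_mem[OF SC(2), of x] \<open>x \<notin> span S\<close> show False by auto
    qed
  qed
  obtain ws where ws: "set ws = S" "distinct ws"
    using finite_distinct_list[OF S(2)] by blast
  have len: "length ws = rank A"
    using rank_card_indpt[OF A S(1)] distinct_card[OF ws(2)] ws(1) by simp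
  define U where "U = mat_of_cols n ws"
  have U: "U \<in> carrier_mat n (rank A)"
    using len by (auto simp: U_def)
  have "\<exists>w. w \<in> carrier_vec (rank A) \<and> col A j = U *\<^sub>v w" if "j < nc" for j
  proof -
    have "col A j \<in> span S"
      using span that A by (auto simp: cols_def)
    then obtain a where "col A j = lincomb a S"
      using finite_in_span[OF S(2)] SC by (metis module_vec_simps(3))
    also have "\<dots> = lincomb_list (\<lambda>i. a (ws ! i)) ws"
      using lincomb_as_lincomb_list_distinct[of ws a] ws SC by simp
    also have "\<dots> = U *\<^sub>v vec (length ws) (\<lambda>i. a (ws ! i))"
      unfolding U_def by (rule lincomb_list_as_mat_mult) (use ws SC in auto)
    finally show ?thesis using len by (auto intro!: exI[of _ "vec (rank A) (\<lambda>i. a (ws ! i))"])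
  qed
  then obtain w where w: "\<And>j. j < nc \<Longrightarrow> w j \<in> carrier_vec (rank A) \<and> col A j = U *\<^sub>v w j"
    by metis
  define W where "W = mat_of_cols (rank A) (map w [0..<nc])"
  have W: "W \<in> carrier_mat (rank A) nc" by (auto simp: W_def)
  have "A = U * W"
  proof (rule mat_col_eqI)
    fix j assume "j < dim_col (U * W)"
    then have j: "j < nc" using W by simp
    then have "col W j = w j" using w by (auto simp: W_def)
    then show "col A j = col (U * W) j"
      by (metis col_mult2[OF U W j] w[OF j])
  qed (use A U W in auto)
  with U W that show thesis by blast
qed

lemma char_poly_eq_det_linear:
  assumes A: "A \<in> carrier_mat n n" and N: "N \<in> carrier_mat n n" and AN: "A + c \<cdot>\<^sub>m 1\<^sub>m n = N"
  shows "char_poly A = det ([:c, 1:] \<cdot>\<^sub>m 1\<^sub>m n - map_mat (\<lambda>a. [:a:]) N)"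
  unfolding char_poly_def AN[symmetric]
  by (rule arg_cong[of _ _ det], rule eq_matI) (use A in \<open>auto simp: char_poly_matrix_def one_pCons\<close>)

text \<open>With \<open>M = U * W\<close>, the characteristic matrix is \<open>?y\<close> times the
  identity minus a product through dimension \<open>rank M\<close>. The determinant identity trades
  \<open>?y ^ rank M\<close> for \<open>?y ^ n\<close>, and cancelling leaves the claimed
  power.\<close>

lemma linear_power_dvd_char_poly:
  fixes A :: "'a :: field mat"
  assumes A: "A \<in> carrier_mat n n" and M: "M \<in> carrier_mat n nc" and N: "N \<in> carrier_mat nc n"
    and AMN: "A + c \<cdot>\<^sub>m 1\<^sub>m n = M * N"
  shows "[:c, 1:] ^ (n - vec_space.rank n M) dvd char_poly A"
proof -
  interpret vec_space "TYPE('a)" n .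
  interpret C: comm_ring_hom "\<lambda>a::'a. [:a:]"
    by unfold_locales (auto simp: one_pCons)
  obtain U W where U: "U \<in> carrier_mat n (rank M)" and W: "W \<in> carrier_mat (rank M) nc" and MUW: "M = U * W"
    by (rule rank_factorization[OF M])
  let ?y = "[:c, 1:]" and ?U = "map_mat (\<lambda>a. [:a:]) U" and ?W = "map_mat (\<lambda>a. [:a:]) (W * N)"
  have "M * N = U * (W * N)"
    unfolding MUW using U W N by simp
  moreover have "M * N \<in> carrier_mat n n" using M N by simp
  ultimately have "char_poly A = det (?y \<cdot>\<^sub>m 1\<^sub>m n - ?U * ?W)"
    using char_poly_eq_det_linear[OF A _ AMN] C.mat_hom_mult[OF U, of "W * N" n] W N by simp
  then have *: "?y ^ rank M * char_poly A = ?y ^ n * det (?y \<cdot>\<^sub>m 1\<^sub>m (rank M) - ?W * ?U)"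
    using det_smult_one_minus_mult_commute[of ?U n "rank M" ?W ?y] U W N by simp
  \<comment> \<open>If \<open>rank M\<close> exceeded \<open>n\<close>, the truncated exponent would
    be 0, so the bound on the rank need not be proved.\<close>
  show ?thesis
  proof (cases "rank M \<le> n")
    case True
    then have "?y ^ n = ?y ^ rank M * ?y ^ (n - rank M)"
      by (simp flip: power_add)
    with * have "?y ^ rank M * char_poly A = ?y ^ rank M *
        (?y ^ (n - rank M) * det (?y \<cdot>\<^sub>m 1\<^sub>m (rank M) - ?W * ?U))"
      by (simp only: mult.assoc)
    then show ?thesis
      by (metis dvd_triv_left mult_left_cancel pCons_eq_0_iff power_not_zero zero_neq_one)
  qed simp
qed

section \<open>The complex spectrum of a strongly regular graph\<close>

lemma sum_diag_mult_commute:
  fixes A :: "'a :: comm_semiring_0 mat"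
  assumes "A \<in> carrier_mat n m" "B \<in> carrier_mat m n"
  shows "(\<Sum>i<n. (A * B) $$ (i, i)) = (\<Sum>i<m. (B * A) $$ (i, i))"
proof -
  have "(\<Sum>i<n. (A * B) $$ (i, i)) = (\<Sum>i<n. \<Sum>j<m. A $$ (i, j) * B $$ (j, i))"
    using assms by (auto simp: scalar_prod_def lessThan_atLeast0)
  also have "\<dots> = (\<Sum>j<m. \<Sum>i<n. A $$ (i, j) * B $$ (j, i))"
    by (rule sum.swap)
  also have "\<dots> = (\<Sum>i<m. (B * A) $$ (i, i))"
    using assms by (auto simp: scalar_prod_def lessThan_atLeast0 mult.commute)
  finally show ?thesis .
qed

text \<open>A Schur decomposition makes \<open>A\<close> similar to a matrix with diagonal
  \<open>es\<close>, and similarity preserves the trace.\<close>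

lemma sum_list_roots_char_poly:
  fixes A :: "complex mat"
  assumes A: "A \<in> carrier_mat n n" and cp: "char_poly A = (\<Prod>e\<leftarrow>es. [:- e, 1:])"
  shows "sum_list es = (\<Sum>i<n. A $$ (i, i))"
proof -
  obtain B P Q where "schur_decomposition A es = (B, P, Q)"
    by (cases "schur_decomposition A es") auto
  from schur_decomposition[OF A cp this]
  have sim: "similar_mat_wit A B P Q" and diag: "diag_mat B = es" by auto
  note D = similar_mat_witD2[OF A sim]
  have "(\<Sum>i<n. A $$ (i, i)) = (\<Sum>i<n. (Q * (P * B)) $$ (i, i))"
    unfolding D(3) by (rule sum_diag_mult_commute) (use D in auto)
  also have "Q * (P * B) = B"
    using D by (simp flip: assoc_mult_mat)
  also have "(\<Sum>i<n. B $$ (i, i)) = sum_list (diag_mat B)"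
    using D by (simp add: diag_mat_def interv_sum_list_conv_sum_set_nat lessThan_atLeast0)
  finally show ?thesis using diag by simp
qed

text \<open>The all-ones matrix is a column times a row, so the determinant identity reduces this to
  a 1 by 1 determinant.\<close>

lemma det_smult_one_minus_all_ones:
  fixes y c :: "'a :: idom"
  shows "y * det (y \<cdot>\<^sub>m 1\<^sub>m n - c \<cdot>\<^sub>m mat n n (\<lambda>_. 1)) = y ^ n * (y - c * of_nat n)"
proof -
  let ?U = "mat n 1 (\<lambda>_. c)" and ?W = "mat 1 n (\<lambda>_. 1 :: 'a)"
  have "c \<cdot>\<^sub>m mat n n (\<lambda>_. 1) = ?U * ?W"
    by (rule eq_matI) (auto simp: scalar_prod_def)
  moreover have "det (y \<cdot>\<^sub>m 1\<^sub>m 1 - ?W * ?U) = y - c * of_nat n"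
    by (subst det_single) (auto simp: scalar_prod_def mult.commute)
  ultimately show ?thesis
    using det_smult_one_minus_mult_commute[of ?U n 1 ?W y] by simp
qed

lemma poly_char_poly:
  fixes A :: "'a :: field mat"
  assumes "A \<in> carrier_mat n n"
  shows "poly (char_poly A) x = det (x \<cdot>\<^sub>m 1\<^sub>m n - A)"
  unfolding char_poly_matrix[OF assms]
  by (rule arg_cong[of _ _ det], rule eq_matI) (use assms in \<open>auto simp: char_matrix_def\<close>)

text \<open>The multiplicities are built by induction instead of being defined as counts, so
  \<open>a = b\<close> needs no separate treatment.\<close>

lemma prod_list_linear_two_roots:
  assumes "set xs \<subseteq> {a, b :: 'a :: comm_ring_1}"
  obtains f g where "f + g = length xs" "(\<Prod>x\<leftarrow>xs. [:- x, 1:]) = [:- a, 1:] ^ f * [:- b, 1:] ^ g"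
    "sum_list xs = of_nat f * a + of_nat g * b"
proof -
  have "\<exists>f g. f + g = length xs \<and> (\<Prod>x\<leftarrow>xs. [:- x, 1:]) = [:- a, 1:] ^ f * [:- b, 1:] ^ g
    \<and> sum_list xs = of_nat f * a + of_nat g * b"
    using assms
  proof (induction xs)
    case (Cons x xs)
    then obtain f g where fg: "f + g = length xs"
      "(\<Prod>x\<leftarrow>xs. [:- x, 1:]) = [:- a, 1:] ^ f * [:- b, 1:] ^ g"
      "sum_list xs = of_nat f * a + of_nat g * b" by auto
    from Cons.prems consider "x = a" | "x = b" by auto
    then show ?case
    proof cases
      case 1
      then show ?thesis
        using fg by (intro exI[of _ "Suc f"] exI[of _ g]) (simp add: algebra_simps del: mult_pCons_left)
    next
      case 2
      then show ?thesis
        using fg by (intro exI[of _ f] exI[of _ "Suc g"]) (simp add: algebra_simps del: mult_pCons_left)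
    qed
  qed simp
  with that show thesis by blast
qed

context
  fixes A J :: "complex mat" and n :: nat and k l m :: complex
  assumes A: "A \<in> carrier_mat n n" and n: "0 < n"
    and J_def: "J = mat n n (\<lambda>_. 1)"
    and square: "A * A = (k - m) \<cdot>\<^sub>m 1\<^sub>m n + (l - m) \<cdot>\<^sub>m A + m \<cdot>\<^sub>m J"
    and row_sum: "A *\<^sub>v vec n (\<lambda>_. 1) = k \<cdot>\<^sub>v vec n (\<lambda>_. 1)"
begin

text \<open>The hypothesis \<open>square\<close> says that \<open>q\<close> evaluated at
  \<open>A\<close> is \<open>m\<close> times \<open>J\<close>.\<close>

private definition q :: "complex poly" where "q = [:m - k, m - l, 1:]"

private lemma J: "J \<in> carrier_mat n n" by (simp add: J_def)

text \<open>Apply \<open>square\<close> to the all-ones vector, an eigenvector of \<open>A\<close>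
  for \<open>k\<close> and of \<open>J\<close> for \<open>n\<close>, and compare entries at index 0,
  which exists as \<open>0 < n\<close>.\<close>

private lemma poly_q_valency: "poly q k = m * of_nat n"
proof -
  let ?e = "vec n (\<lambda>_. 1 :: complex)"
  have *: "(a \<cdot>\<^sub>m X) *\<^sub>v ?e = a \<cdot>\<^sub>v (X *\<^sub>v ?e)" if "X \<in> carrier_mat n n" for a X
    by (rule eq_vecI) (use that in auto)
  have JA: "J *\<^sub>v ?e = of_nat n \<cdot>\<^sub>v ?e"
    by (rule eq_vecI) (auto simp: J_def scalar_prod_def)
  have "(k * k) \<cdot>\<^sub>v ?e = A *\<^sub>v (A *\<^sub>v ?e)"
    using A by (simp add: row_sum mult_mat_vec[of A n n] smult_smult_assoc)
  also have "\<dots> = (A * A) *\<^sub>v ?e"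
    using A by simp
  also have "\<dots> = (k - m) \<cdot>\<^sub>v ?e + (l - m) \<cdot>\<^sub>v (k \<cdot>\<^sub>v ?e) + m \<cdot>\<^sub>v (of_nat n \<cdot>\<^sub>v ?e)"
    unfolding square using A J
    by (simp add: add_mult_distrib_mat_vec[of _ n n] * row_sum JA)
  finally have "((k * k) \<cdot>\<^sub>v ?e) $ 0 = ((k - m) \<cdot>\<^sub>v ?e + (l - m) \<cdot>\<^sub>v (k \<cdot>\<^sub>v ?e) + m \<cdot>\<^sub>v (of_nat n \<cdot>\<^sub>v ?e)) $ 0"
    by simp
  then show ?thesis
    using n by (simp add: q_def algebra_simps)
qed

text \<open>The roots of \<open>q\<close> sum to \<open>l - m\<close>, so x and
  \<open>l - m - x\<close> have the same value under \<open>q\<close>. Multiplying the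
  characteristic matrices at these two points eliminates \<open>A\<close> by \<open>square\<close>,
  leaving a combination of the identity and \<open>J\<close> whose determinant is known.\<close>

private lemma poly_char_poly_reflect:
  "poly q x * (poly (char_poly A) x * ((- 1) ^ n * poly (char_poly A) (l - m - x)))
    = poly q x ^ n * (poly q x - m * of_nat n)"
proof -
  let ?c = "x + m - l"
  have 1: "(x \<cdot>\<^sub>m 1\<^sub>m n - A) * (?c \<cdot>\<^sub>m 1\<^sub>m n + A) = poly q x \<cdot>\<^sub>m 1\<^sub>m n - m \<cdot>\<^sub>m J"
  proof -
    have cA: "?c \<cdot>\<^sub>m 1\<^sub>m n + A \<in> carrier_mat n n" using A by simp
    have "(x \<cdot>\<^sub>m 1\<^sub>m n - A) * (?c \<cdot>\<^sub>m 1\<^sub>m n + A)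
        = (x \<cdot>\<^sub>m 1\<^sub>m n) * (?c \<cdot>\<^sub>m 1\<^sub>m n + A) - A * (?c \<cdot>\<^sub>m 1\<^sub>m n + A)"
      by (rule minus_mult_distrib_mat[OF _ A cA]) simp
    also have "(x \<cdot>\<^sub>m 1\<^sub>m n) * (?c \<cdot>\<^sub>m 1\<^sub>m n + A) = x \<cdot>\<^sub>m (?c \<cdot>\<^sub>m 1\<^sub>m n + A)"
      unfolding mult_smult_assoc_mat[OF one_carrier_mat cA] left_mult_one_mat[OF cA] ..
    also have "A * (?c \<cdot>\<^sub>m 1\<^sub>m n + A) = ?c \<cdot>\<^sub>m A + A * A"
      using A by (simp add: mult_add_distrib_mat[of _ n n _ n] mult_smult_distrib[of _ n n _ n])
    also have "x \<cdot>\<^sub>m (?c \<cdot>\<^sub>m 1\<^sub>m n + A) - (?c \<cdot>\<^sub>m A + A * A) = poly q x \<cdot>\<^sub>m 1\<^sub>m n - m \<cdot>\<^sub>m J"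
      unfolding square using A J by (intro eq_matI) (auto simp: q_def algebra_simps)
    finally show ?thesis .
  qed
  have "?c \<cdot>\<^sub>m 1\<^sub>m n + A = (- 1) \<cdot>\<^sub>m ((l - m - x) \<cdot>\<^sub>m 1\<^sub>m n - A)"
    using A by (intro eq_matI) (auto simp: algebra_simps)
  then have "det (?c \<cdot>\<^sub>m 1\<^sub>m n + A) = (- 1) ^ n * poly (char_poly A) (l - m - x)"
    using A by (simp add: poly_char_poly[OF A])
  with arg_cong[OF 1, of det] have "poly (char_poly A) x * ((- 1) ^ n * poly (char_poly A) (l - m - x))
      = det (poly q x \<cdot>\<^sub>m 1\<^sub>m n - m \<cdot>\<^sub>m J)"
    using A by (simp add: det_mult[of _ n] poly_char_poly[OF A] minus_carrier_mat)
  then show ?thesis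
    by (simp add: J_def det_smult_one_minus_all_ones)
qed

text \<open>
  Both sides of \<open>poly_char_poly_reflect\<close> are divisible by \<open>(x - k) (x - k')\<close>, where \<open>k' = l - m - k\<close>.
  The quotient of the right-hand side is a power of \<open>q\<close>, so every other root of the characteristic
  polynomial is a root of \<open>q\<close>.
\<close>

lemma srg_char_poly:
  assumes d: "d\<^sup>2 = (l - m)\<^sup>2 + 4 * (k - m)"
  obtains f g where "f + g + 1 = n"
    "char_poly A = [:- k, 1:] * ([:- ((l - m + d) / 2), 1:] ^ f * [:- ((l - m - d) / 2), 1:] ^ g)"
    "k + of_nat f * ((l - m + d) / 2) + of_nat g * ((l - m - d) / 2) = (\<Sum>i<n. A $$ (i, i))"
proof -
  \<comment> \<open>By \<open>poly_q_valency\<close>, \<open>k\<close> is a root of \<open>q\<close>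
    minus the constant \<open>m * of_nat n\<close>; the roots of that quadratic sum to
    \<open>l - m\<close>, so this is the other one.\<close>
  define k' where "k' = l - m - k"
  obtain es where es: "char_poly A = (\<Prod>e\<leftarrow>es. [:- e, 1:])" "length es = n"
    using char_poly_factorized[OF A] by blast
  have "eigenvector A (vec n (\<lambda>_. 1)) k"
    using A row_sum n by (auto simp: eigenvector_def vec_eq_iff)
  then have "poly (char_poly A) k = 0"
    using eigenvalue_root_char_poly[OF A] by (auto simp: eigenvalue_def)
  then have k: "k \<in> set es"
    unfolding es(1) poly_prod_list by (auto simp: prod_list_zero_iff)
  \<comment> \<open>Only one occurrence of \<open>k\<close> is removed; if it recurs in
    \<open>xs\<close>, it must be a root of \<open>q\<close> as well.\<close>
  define xs where "xs = remove1 k es"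
  have mset: "mset es = add_mset k (mset xs)"
    using k by (simp add: xs_def)
  define \<psi> where "\<psi> = (\<Prod>e\<leftarrow>xs. [:- e, 1:])"
  have "prod_mset (image_mset (\<lambda>e. [:- e, 1:]) (mset es)) = [:- k, 1:] * \<psi>"
    unfolding mset \<psi>_def by (simp add: prod_mset_prod_list flip: mset_map)
  then have cp: "char_poly A = [:- k, 1:] * \<psi>"
    unfolding es(1) by (simp add: prod_mset_prod_list flip: mset_map)
  let ?\<phi> = "smult ((- 1) ^ n) (\<psi> \<circ>\<^sub>p [:l - m, - 1:])"
  have kk': "poly q x - m * of_nat n = (x - k) * (x - k')" for x
    using poly_q_valency by (simp add: q_def k'_def algebra_simps)
  have "([:- k, 1:] * [:- k', 1:]) * (- (q * \<psi> * ?\<phi>)) = ([:- k, 1:] * [:- k', 1:]) * q ^ n"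
  proof (rule poly_ext)
    fix x
    have "poly q x * (((x - k) * poly \<psi> x) * ((- 1) ^ n * ((k' - x) * poly \<psi> (l - m - x))))
        = poly q x ^ n * ((x - k) * (x - k'))"
      using poly_char_poly_reflect[of x] unfolding cp kk' by (simp add: k'_def algebra_simps)
    then show "poly (([:- k, 1:] * [:- k', 1:]) * (- (q * \<psi> * ?\<phi>))) x
        = poly (([:- k, 1:] * [:- k', 1:]) * q ^ n) x"
      by (simp add: poly_pcompose algebra_simps)
  qed
  \<comment> \<open>Cancelling polynomials rather than values keeps the identity valid at
    \<open>k\<close> and \<open>k'\<close> too.\<close>
  then have dvd: "- (q * \<psi> * ?\<phi>) = q ^ n"
    by (rule iffD1[OF mult_left_cancel, rotated]) simp
  have "set xs \<subseteq> {(l - m + d) / 2, (l - m - d) / 2}"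
  proof
    fix x assume "x \<in> set xs"
    then have "poly \<psi> x = 0"
      by (auto simp: \<psi>_def poly_prod_list prod_list_zero_iff)
    then have "poly (q ^ n) x = 0"
      unfolding dvd[symmetric] by simp
    then have "poly q x = 0" by simp
    \<comment> \<open>Completing the square in \<open>q\<close>, whose discriminant is the square of
      \<open>d\<close>.\<close>
    moreover have "(2 * x - (l - m))\<^sup>2 = d\<^sup>2 + 4 * poly q x"
      unfolding d by (simp add: q_def power2_eq_square algebra_simps)
    ultimately have "(2 * x - (l - m))\<^sup>2 = d\<^sup>2"
      by simp
    then show "x \<in> {(l - m + d) / 2, (l - m - d) / 2}"
      by (auto simp: power2_eq_iff field_simps)
  qed
  then obtain f g where fg: "f + g = length xs"
    "\<psi> = [:- ((l - m + d) / 2), 1:] ^ f * [:- ((l - m - d) / 2), 1:] ^ g"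
    "sum_list xs = of_nat f * ((l - m + d) / 2) + of_nat g * ((l - m - d) / 2)"
    unfolding \<psi>_def by (rule prod_list_linear_two_roots)
  have "length es = length xs + 1" "sum_list es = k + sum_list xs"
    using arg_cong[OF mset, of size] arg_cong[OF mset, of sum_mset] by (auto simp: sum_mset_sum_list)
  with fg es sum_list_roots_char_poly[OF A es(1)] cp that[of f g] show thesis
    by (simp add: add.assoc)
qed

end

section \<open>Root multiplicities over the field with two elements\<close>

text \<open>\<open>b\<close> and \<open>b + 1\<close> differ, so \<open>c\<close> matches only one
  of them; the factor with \<open>a\<close> contributes at most one more.\<close>

lemma linear_power_dvd_bit_linear_factors:
  fixes a b c :: bit
  assumes "[:c, 1:] ^ j dvd [:a, 1:] * ([:b, 1:] ^ f * [:b + 1, 1:] ^ g)"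
  shows "j \<le> 1 + max f g"
proof -
  let ?p = "[:a, 1:] * ([:b, 1:] ^ f * [:b + 1, 1:] ^ g)"
  have nz: "?p \<noteq> 0" by (simp del: mult_pCons_left)
  then have nz': "[:b, 1:] ^ f * [:b + 1, 1:] ^ g \<noteq> 0" by simp
  then have ord: "order (- c) ?p =
      (if a = c then 1 else 0) + ((if b = c then f else 0) + (if b + 1 = c then g else 0))"
    by (simp only: order_mult[OF nz] order_mult[OF nz'] order_linear_power order_linear' minus_minus)
  have "j \<le> order (- c) ?p"
    using assms nz order_divides[of "- c" j ?p] by simp
  then show ?thesis
    unfolding ord by (cases b; cases c; auto split: if_splits)
qed

text \<open>For \<open>e = 0\<close> the quadratic splits into the two distinct linear factors of
  the previous lemma; for \<open>e = 1\<close> it has no root, and only the factor with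
  \<open>a\<close> can contribute.\<close>

lemma linear_power_dvd_bit_quadratic_power:
  fixes a c e :: bit
  assumes "[:c, 1:] ^ j dvd [:a, 1:] * [:e, 1, 1:] ^ f"
  shows "j \<le> 1 + f"
proof (cases e)
  case zero
  have "[:e, 1, 1:] = [:0, 1:] * [:0 + 1, 1:]" by (simp add: zero)
  with assms have "[:c, 1:] ^ j dvd [:a, 1:] * ([:0, 1:] ^ f * [:0 + 1, 1:] ^ f)"
    by (simp only: power_mult_distrib)
  from linear_power_dvd_bit_linear_factors[OF this] show ?thesis by simp
next
  case one
  have nz: "[:a, 1:] * [:e, 1, 1:] ^ f \<noteq> 0" by (simp del: mult_pCons_left)
  have "poly ([:e, 1, 1:] ^ f) (- c) \<noteq> 0"
    by (cases c) (simp_all add: one)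
  then have "order (- c) ([:a, 1:] * [:e, 1, 1:] ^ f) \<le> 1"
    unfolding order_mult[OF nz] by (simp add: order_0I order_linear')
  moreover have "j \<le> order (- c) ([:a, 1:] * [:e, 1, 1:] ^ f)"
    using assms nz order_divides[of "- c" j "[:a, 1:] * [:e, 1, 1:] ^ f"] by simp
  ultimately show ?thesis by simp
qed

lemma of_int_bit: "of_int z = (if even z then 0 else 1 :: bit)"
  by (auto elim!: evenE oddE)

section \<open>Adjacency and incidence matrices\<close>

lemma sum_nth_indicator:
  assumes "distinct xs"
  shows "(\<Sum>i<length xs. if Q (xs ! i) then 1 else 0 :: 'a :: semiring_1) = of_nat (card {x \<in> set xs. Q x})"
proof -
  have "(\<Sum>i<length xs. if Q (xs ! i) then 1 else 0 :: 'a) = (\<Sum>x\<leftarrow>xs. if Q x then 1 else 0)"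
    by (simp add: sum_list_sum_nth lessThan_atLeast0)
  also have "\<dots> = (\<Sum>x\<in>set xs. if Q x then 1 else 0)"
    using assms by (simp add: sum_list_distinct_conv_sum_set)
  also have "\<dots> = of_nat (card {x \<in> set xs. Q x})"
    by (simp add: sum.If_cases Int_def)
  finally show ?thesis .
qed

text \<open>The entry type is polymorphic because one matrix is read over the integers, the complex
  numbers and \<open>bit\<close>; its integer characteristic polynomial links the last two.\<close>

definition adjacency_matrix :: "'a list \<Rightarrow> ('a \<Rightarrow> 'a \<Rightarrow> bool) \<Rightarrow> 'f :: zero_neq_one mat" where
  "adjacency_matrix xs adj =
     mat (length xs) (length xs) (\<lambda>(i, j). if adj (xs ! i) (xs ! j) then 1 else 0)"

lemma adjacency_matrix_carrier [simp]:
  "(adjacency_matrix xs adj :: 'f :: zero_neq_one mat) \<in> carrier_mat (length xs) (length xs)"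
  by (simp add: adjacency_matrix_def)

lemma map_mat_of_int_adjacency_matrix:
  "map_mat of_int (adjacency_matrix xs adj) = (adjacency_matrix xs adj :: 'f :: ring_1 mat)"
  by (rule eq_matI) (auto simp: adjacency_matrix_def)

context strongly_regular_graph
begin

text \<open>Entries of \<open>A * A\<close> count common neighbours: \<open>k\<close> on the
  diagonal, \<open>l\<close> for adjacent and \<open>m\<close> for distinct non-adjacent
  vertices.\<close>

lemma adjacency_matrix_square:
  fixes xs and n
  defines "n \<equiv> length xs" and "A \<equiv> adjacency_matrix xs adj :: 'f :: comm_ring_1 mat"
  assumes xs: "distinct xs" "set xs = V"
  shows "A * A = (of_nat k - of_nat m) \<cdot>\<^sub>m 1\<^sub>m n + (of_nat l - of_nat m) \<cdot>\<^sub>m A + of_nat m \<cdot>\<^sub>m mat n n (\<lambda>_. 1)"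
    (is "_ = ?R")
proof (rule eq_matI)
  fix i j assume "i < dim_row ?R" "j < dim_col ?R"
  then have ij: "i < n" "j < n" by auto
  let ?x = "xs ! i" and ?y = "xs ! j"
  have V: "?x \<in> V" "?y \<in> V" using ij xs by (auto simp: n_def)
  have "(A * A) $$ (i, j) = (\<Sum>z<n. (if adj ?x (xs ! z) then 1 else 0) * (if adj (xs ! z) ?y then 1 else 0))"
    using ij by (auto simp: A_def adjacency_matrix_def n_def scalar_prod_def lessThan_atLeast0)
  also have "\<dots> = (\<Sum>z<n. if adj ?x (xs ! z) \<and> adj ?y (xs ! z) then 1 else 0)"
    by (rule sum.cong) (use V adj_sym xs in \<open>auto simp: n_def\<close>)
  also have "\<dots> = of_nat (card {z \<in> V. adj ?x z \<and> adj ?y z})"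
    unfolding n_def using sum_nth_indicator[OF xs(1)] xs(2) by simp
  also have "\<dots> = ?R $$ (i, j)"
  proof (cases "i = j")
    case True
    then show ?thesis
      using ij V regular adj_irrefl by (simp add: A_def adjacency_matrix_def n_def)
  next
    case False
    then have "?x \<noteq> ?y" using ij xs by (simp add: n_def nth_eq_iff_index_eq)
    with False show ?thesis
      using ij V common_adj[of ?x ?y] common_nonadj[of ?x ?y]
      by (simp add: A_def adjacency_matrix_def n_def)
  qed
  finally show "(A * A) $$ (i, j) = ?R $$ (i, j)" .
qed (auto simp: A_def adjacency_matrix_def n_def)

lemma adjacency_matrix_row_sum:
  fixes xs and n
  defines "n \<equiv> length xs" and "A \<equiv> adjacency_matrix xs adj :: 'f :: comm_ring_1 mat"
  assumes xs: "distinct xs" "set xs = V"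
  shows "A *\<^sub>v vec n (\<lambda>_. 1) = of_nat k \<cdot>\<^sub>v vec n (\<lambda>_. 1)"
proof (rule eq_vecI)
  fix i assume "i < dim_vec (of_nat k \<cdot>\<^sub>v vec n (\<lambda>_. 1 :: 'f))"
  then have i: "i < n" by simp
  then have V: "xs ! i \<in> V" using xs by (auto simp: n_def)
  have "(A *\<^sub>v vec n (\<lambda>_. 1)) $ i = (\<Sum>z<n. if adj (xs ! i) (xs ! z) then 1 else 0)"
    using i by (auto simp: A_def adjacency_matrix_def n_def scalar_prod_def lessThan_atLeast0)
  also have "\<dots> = of_nat k"
    unfolding n_def using sum_nth_indicator[OF xs(1), of "adj (xs ! i)"] xs(2) regular[OF V] by simp
  finally show "(A *\<^sub>v vec n (\<lambda>_. 1)) $ i = (of_nat k \<cdot>\<^sub>v vec n (\<lambda>_. 1)) $ i"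
    using i by simp
qed (simp add: A_def adjacency_matrix_def n_def)

end

text \<open>Entries of the product count blocks through two points: \<open>t + 1\<close> for equal
  points, otherwise 1 or 0 according to joinedness, as two points share at most one block.\<close>

lemma (in generalized_partial_geometry) adjacency_matrix_eq_incidence_mult_transpose:
  assumes ps: "distinct ps" "set ps = P" and bs: "distinct bs" "set bs = B"
  shows "adjacency_matrix ps (point_graph_adj B) + of_nat (t + 1) \<cdot>\<^sub>m 1\<^sub>m (length ps)
    = (incidence_matrix ps bs :: 'f :: comm_ring_1 mat) * transpose_mat (incidence_matrix ps bs)"
    (is "?L = ?R")
proof (rule eq_matI)
  fix i j assume "i < dim_row ?R" "j < dim_col ?R"
  then have ij: "i < length ps" "j < length ps" by (auto simp: incidence_matrix_def)
  let ?p = "ps ! i" and ?q = "ps ! j"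
  have P: "?p \<in> P" "?q \<in> P" using ij ps by auto
  have "?R $$ (i, j) = (\<Sum>b<length bs. (if ?p \<in> bs ! b then 1 else 0) * (if ?q \<in> bs ! b then 1 else 0))"
    using ij by (auto simp: incidence_matrix_def scalar_prod_def lessThan_atLeast0)
  also have "\<dots> = (\<Sum>b<length bs. if ?p \<in> bs ! b \<and> ?q \<in> bs ! b then 1 else 0)"
    by (rule sum.cong) auto
  also have "\<dots> = of_nat (card {b \<in> B. ?p \<in> b \<and> ?q \<in> b})"
    using sum_nth_indicator[OF bs(1), of "\<lambda>b. ?p \<in> b \<and> ?q \<in> b"] bs(2) by simp
  also have "\<dots> = ?L $$ (i, j)"
  proof (cases "i = j")
    case True
    then show ?thesis
      using ij point_degree[OF P(1)] by (simp add: adjacency_matrix_def point_graph_adj_def)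
  next
    case False
    then have ne: "?p \<noteq> ?q" using ij ps by (simp add: nth_eq_iff_index_eq)
    show ?thesis
    proof (cases "joined B ?p ?q")
      case True
      then obtain b where b: "b \<in> B" "?p \<in> b" "?q \<in> b" by (auto simp: joined_def)
      then have "{b \<in> B. ?p \<in> b \<and> ?q \<in> b} = {b}"
        using at_most_one_block[OF P ne] by blast
      with True False ne ij show ?thesis by (simp add: adjacency_matrix_def point_graph_adj_def)
    next
      case nj: False
      then have "{b \<in> B. ?p \<in> b \<and> ?q \<in> b} = {}" by (auto simp: joined_def)
      then have "card {b \<in> B. ?p \<in> b \<and> ?q \<in> b} = 0" by (simp only: card.empty)
      with nj False ne ij show ?thesis by (simp add: adjacency_matrix_def point_graph_adj_def)
    qed
  qed
  finally show "?L $$ (i, j) = ?R $$ (i, j)" by simp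
qed (auto simp: incidence_matrix_def adjacency_matrix_def)

section \<open>Reduction modulo 2 and the rank bound\<close>

text \<open>A complex factorization can be reduced modulo 2 only once its factors are integral. In
  both cases such factors are found, the identity is pulled back to \<open>int\<close> by
  injectivity of the embedding, and then mapped to \<open>bit\<close>.\<close>

lemma bit_srg_char_poly_multiplicity:
  fixes p :: "int poly" and k l m :: int and d :: complex and v f g j :: nat and c :: bit
  assumes p: "map_poly of_int p = [:- of_int k, 1:] *
      ([:- ((of_int l - of_int m + d) / 2), 1:] ^ f * [:- ((of_int l - of_int m - d) / 2), 1:] ^ g)"
    and d: "d\<^sup>2 = (of_int l - of_int m)\<^sup>2 + 4 * (of_int k - of_int m)"
    and trace: "(of_nat f - of_nat g) * d = of_int e"
    and parity: "odd (l - m)"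
    and dvd: "[:c, 1:] ^ j dvd map_poly of_int p"
  shows "j \<le> 1 + max f g"
proof (cases "f = g")
  case True
  \<comment> \<open>With equal exponents the linear factors pair up, and \<open>d\<close> enters
    only through its square, an integer.\<close>
  have "[:- ((of_int l - of_int m + d) / 2), 1:] * [:- ((of_int l - of_int m - d) / 2), 1:]
      = [:of_int (m - k), of_int (m - l), 1 :: complex:]"
    using d by (simp add: power2_eq_square field_simps)
  then have "map_poly of_int p = [:- of_int k, 1:] * [:of_int (m - k), of_int (m - l), 1 :: complex:] ^ f"
    unfolding p True power_mult_distrib[symmetric] by (simp only:)
  also have "\<dots> = map_poly of_int ([:- k, 1:] * [:m - k, m - l, 1:] ^ f)"
    by (simp add: hom_distribs del: mult_pCons_left)
  finally have "p = [:- k, 1:] * [:m - k, m - l, 1:] ^ f"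
    by (simp only: of_int_poly_hom.eq_iff)
  then have "map_poly of_int p = [:- of_int k, 1:] * [:of_int (m - k), of_int (m - l), 1 :: bit:] ^ f"
    by (simp add: hom_distribs del: mult_pCons_left)
  moreover have "of_int (m - l) = (1 :: bit)"
    unfolding of_int_bit using parity by simp
  ultimately show ?thesis
    using dvd linear_power_dvd_bit_quadratic_power True by (metis max.idem)
next
  case False
  define D where "D = (l - m)\<^sup>2 + 4 * (k - m)"
  \<comment> \<open>Here \<open>d\<close> is the rational number \<open>e\<close> over
    \<open>f - g\<close> with integral square; divisibility of the squares gives divisibility of
    \<open>e\<close> itself, so \<open>d\<close> is an integer.\<close>
  have "of_int ((int f - int g)\<^sup>2 * D) = (((of_nat f - of_nat g) * d)\<^sup>2 :: complex)"
    by (simp add: power_mult_distrib d D_def)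
  also have "\<dots> = of_int (e\<^sup>2)"
    unfolding trace by simp
  finally have "(int f - int g)\<^sup>2 * D = e\<^sup>2"
    by (simp only: of_int_eq_iff)
  then have "(int f - int g)\<^sup>2 dvd e\<^sup>2"
    by (metis dvd_triv_left)
  then have "int f - int g dvd e" by simp
  then obtain d0 where d0: "e = (int f - int g) * d0" ..
  have "(of_nat f - of_nat g) * d = (of_nat f - of_nat g) * of_int d0"
    unfolding trace d0 by simp
  with False have dd: "d = of_int d0" by simp
  then have "of_int (d0\<^sup>2) = (of_int D :: complex)"
    using d by (simp add: D_def)
  then have "d0\<^sup>2 = D" by (simp only: of_int_eq_iff)
  moreover have "odd D" using parity by (simp add: D_def)
  ultimately have "odd d0" by (metis even_power zero_neq_numeral zero_less_numeral)
  with parity have "even (l - m + d0)" by simp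
  then obtain a where a: "l - m + d0 = 2 * a" ..
  \<comment> \<open>The two roots sum to the odd number \<open>l - m\<close>, so \<open>a\<close>
    and \<open>b\<close> have opposite parity.\<close>
  define b where "b = l - m - a"
  have "of_int l - of_int m + d = 2 * of_int a" "of_int l - of_int m - d = 2 * of_int b"
    using arg_cong[OF a, of "of_int :: int \<Rightarrow> complex"] by (simp_all add: dd b_def algebra_simps)
  then have ab: "(of_int l - of_int m + d) / 2 = of_int a" "(of_int l - of_int m - d) / 2 = of_int b"
    by simp_all
  have "map_poly of_int p = (map_poly of_int ([:- k, 1:] * ([:- a, 1:] ^ f * [:- b, 1:] ^ g)) :: complex poly)"
    unfolding p ab by (simp add: hom_distribs del: mult_pCons_left)
  then have "p = [:- k, 1:] * ([:- a, 1:] ^ f * [:- b, 1:] ^ g)"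
    by (simp only: of_int_poly_hom.eq_iff)
  then have "map_poly of_int p = [:- of_int k, 1:] * ([:- of_int a, 1:] ^ f * [:- of_int b, 1 :: bit:] ^ g)"
    by (simp add: hom_distribs del: mult_pCons_left)
  moreover have "- of_int b = - of_int a + (1 :: bit)"
    using parity by (auto simp: of_int_bit b_def)
  ultimately show ?thesis
    using dvd linear_power_dvd_bit_linear_factors by metis
qed

text \<open>If \<open>f = g\<close>, then \<open>e = 0\<close> and the fraction vanishes whatever
  the sign of \<open>D\<close>. Otherwise \<open>d\<close> is real, so \<open>e / sqrt D\<close> is
  \<open>f - g\<close> up to a sign that the minimum absorbs; \<open>D = 0\<close> would make the
  fraction 0 by convention and break the formula.\<close>

lemma min_multiplicity_formula:
  fixes f g :: nat and d :: complex and e D :: real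
  assumes trace: "(of_nat f - of_nat g) * d = of_real e"
    and d: "d\<^sup>2 = of_real D" and D: "D \<noteq> 0"
  shows "min (1 / 2 * ((real f + real g) - e / sqrt D)) (1 / 2 * ((real f + real g) + e / sqrt D))
    = real (min f g)"
proof (cases "f = g")
  case True
  then have "e = 0" using trace by simp
  with True show ?thesis by simp
next
  case False
  define y where "y = e / (real f - real g)"
  have "d = of_real y"
    using trace False by (simp add: y_def field_simps)
  with d have "of_real (y\<^sup>2) = (of_real D :: complex)" by simp
  then have D': "D = y\<^sup>2" by (simp only: of_real_eq_iff)
  have "e = (real f - real g) * y" using False by (simp add: y_def)
  moreover have "y \<noteq> 0" using D D' by auto
  ultimately have "e / sqrt D = real f - real g \<or> e / sqrt D = - (real f - real g)"
    by (auto simp: D' abs_if)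
  then show ?thesis by (elim disjE; simp only:; auto simp: min_def)
qed

theorem theorem4p4:
  fixes P :: "'a set" and B :: "'a set set"
    and s t r l m v k :: nat and As :: "nat set" and \<Delta> :: real
    and ps :: "'a list" and bs :: "'a set list" and M :: "bit mat"
  assumes "strongly_regular_pg P B s t r As l m"
    and "v = card P"
    and "k = s * (t + 1)"
    and "\<Delta> = (real l - real m)\<^sup>2 + 4 * (real k - real m)"
    and "[int l - int m = 1] (mod 2)"
    and "distinct ps" and "set ps = P"
    and "distinct bs" and "set bs = B"
    and "M = incidence_matrix ps bs"
  shows "real (rank2 M) \<ge>
    min (1 / 2 * ((real v - 1) - ((real v - 1) * (real m - real l) - 2 * real k) / sqrt \<Delta>))
        (1 / 2 * ((real v - 1) + ((real v - 1) * (real m - real l) - 2 * real k) / sqrt \<Delta>))"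
proof -
  interpret strongly_regular_pg P B s t r As l m by fact
  note ps = assms(6,7) and bs = assms(8,9)
  have v: "length ps = v" "0 < v"
    using distinct_card[OF ps(1)] ps(2) assms(2) finite_points points_nonempty
    by (auto simp: card_gt_0_iff)
  have parity: "odd (int l - int m)"
    using assms(5) unfolding cong_def by presburger
  define A :: "int mat" where "A = adjacency_matrix ps (point_graph_adj B)"
  have A: "A \<in> carrier_mat v v" by (simp add: A_def flip: v(1))
  have map_A: "map_mat of_int A = adjacency_matrix ps (point_graph_adj B)"
    by (simp only: A_def map_mat_of_int_adjacency_matrix)
  \<comment> \<open>A complex root exists without knowing the sign of
    \<open>\<Delta>\<close>.\<close>
  define d where "d = csqrt (of_real \<Delta>)"
  have d: "d\<^sup>2 = of_real \<Delta>" by (simp add: d_def)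
  have AC: "map_mat of_int A \<in> carrier_mat v v" using A by simp
  have "d\<^sup>2 = (of_nat l - of_nat m)\<^sup>2 + 4 * (of_nat k - of_nat m)"
    unfolding d assms(4) by simp
  from srg_char_poly[OF AC v(2) refl _ _ this]
    adjacency_matrix_square[OF ps, where ?'f = complex]
    adjacency_matrix_row_sum[OF ps, where ?'f = complex]
  obtain f g where fg: "f + g + 1 = v"
    "char_poly (map_mat of_int A) = [:- of_nat k, 1:] * ([:- ((of_nat l - of_nat m + d) / 2), 1:] ^ f
      * [:- ((of_nat l - of_nat m - d) / 2), 1:] ^ g)"
    "of_nat k + of_nat f * ((of_nat l - of_nat m + d) / 2) + of_nat g * ((of_nat l - of_nat m - d) / 2)
      = (\<Sum>i<v. map_mat of_int A $$ (i, i))"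
    unfolding map_A v(1) assms(3)[symmetric] by blast
  have "(\<Sum>i<v. map_mat of_int A $$ (i, i)) = (0 :: complex)"
    unfolding map_A by (rule sum.neutral) (auto simp: adjacency_matrix_def point_graph_adj_def v(1))
  \<comment> \<open>Twice the trace, sorted by \<open>d\<close>. As the trace is 0 and
    \<open>f + g = v - 1\<close>, the numerator in the theorem equals \<open>f - g\<close> times
    \<open>d\<close>.\<close>
  moreover have "(of_nat f - of_nat g) * d - (of_nat (f + g) * (of_nat m - of_nat l) - 2 * of_nat k)
      = 2 * (of_nat k + of_nat f * ((of_nat l - of_nat m + d) / 2) + of_nat g * ((of_nat l - of_nat m - d) / 2))"
    by (simp add: field_simps)
  ultimately have trace: "(of_nat f - of_nat g) * d = of_nat (f + g) * (of_nat m - of_nat l) - 2 * of_nat k"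
    unfolding fg(3) by simp
  have "[:of_nat (t + 1), 1:] ^ (v - vec_space.rank v M) dvd char_poly (map_mat of_int A :: bit mat)"
    using adjacency_matrix_eq_incidence_mult_transpose[OF ps bs, where ?'f = bit]
      adjacency_matrix_carrier[of ps "point_graph_adj B", where ?'f = bit]
    by (intro linear_power_dvd_char_poly[where N = "transpose_mat M" and nc = "length bs"])
      (simp_all add: map_A assms(10) incidence_matrix_def v(1))
  then have dvd: "[:of_nat (t + 1), 1:] ^ (v - vec_space.rank v M) dvd (map_poly of_int (char_poly A) :: bit poly)"
    by (simp only: of_int_hom.char_poly_hom[OF A])
  have "v - vec_space.rank v M \<le> 1 + max f g"
  proof (rule bit_srg_char_poly_multiplicity[where k = "int k" and l = "int l" and m = "int m"
        and d = d, OF _ _ _ parity dvd])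
    show "(of_nat f - of_nat g) * d = of_int (int (f + g) * (int m - int l) - 2 * int k)"
      unfolding trace by simp
  qed (use fg(2) in \<open>simp_all add: of_int_hom.char_poly_hom[OF A] d assms(4)\<close>)
  moreover have "rank2 M = vec_space.rank v M"
    by (simp add: rank2_def assms(10) incidence_matrix_def v(1))
  \<comment> \<open>Since \<open>v = f + g + 1\<close>, the bound \<open>1 + max f g\<close> on the
    corank leaves \<open>min f g\<close> for the rank.\<close>
  ultimately have "min f g \<le> rank2 M"
    using fg(1) by linarith
  \<comment> \<open>\<open>\<Delta>\<close> is an integer with the parity of \<open>l - m\<close>,
    hence odd.\<close>
  moreover have "\<Delta> \<noteq> 0"
  proof
    assume "\<Delta> = 0"
    then have "real_of_int ((int l - int m)\<^sup>2 + 4 * (int k - int m)) = 0"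
      using assms(4) by simp
    then have "(int l - int m)\<^sup>2 + 4 * (int k - int m) = 0"
      by (simp only: of_int_eq_0_iff)
    then have "even ((int l - int m)\<^sup>2 + 4 * (int k - int m))" by simp
    with parity show False by simp
  qed
  then have "min (1 / 2 * ((real f + real g) - ((real f + real g) * (real m - real l) - 2 * real k) / sqrt \<Delta>))
      (1 / 2 * ((real f + real g) + ((real f + real g) * (real m - real l) - 2 * real k) / sqrt \<Delta>)) = real (min f g)"
    by (intro min_multiplicity_formula[OF _ d]) (simp_all add: trace)
  moreover have "real v - 1 = real f + real g"
    using fg(1) by auto
  ultimately show ?thesis
    by simp
qed

end
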